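(* Let $q\geq 2$ and $n\geq 2$ be integers. The map $d\colon(\mathbb{R}^q)^n\to\mathbb{R}_+$ that carries $(x_1,\ldots,x_n)$ into the total length of a minimal spanning tree of $\mathcal{G}(x_1,\ldots,x_n)$ is an $n$-distance on $\mathbb{R}^q$. Moreover, its best constant satisfies $K^*_n\leq\frac{2}{n}$, and this inequality is strict whenever $n\geq 3$.
   Context: $\mathbb{R}_+=[0,+\infty[$. For points $x_1,\ldots,x_n\in\mathbb{R}^q$, $\mathcal{G}(x_1,\ldots,x_n)$ denotes the complete Euclidean graph whose vertex set is the set $\{x_1,\ldots,x_n\}$, i.e., the complete graph on this set in which each edge has length equal to the Euclidean distance between its endpoints. A minimal spanning tree is a spanning tree of least total edge length (this length is $0$ if the vertex set is a singleton). For a set $X$ with at least two elements and an integer $n\geq 2$, an $n$-distance on $X$ is a map $d\colon X^n\to\mathbb{R}_+$ such that: (i) $d(x_1,\ldots,x_n)=0$ if and only if $x_1=\cdots=x_n$; (ii) $d$ is invariant under any permutation of its arguments; (iii) (simplex inequality) $d(x_1,\ldots,x_n)\leq\sum_{i=1}^n d(x_1,\ldots,x_n)_i^z$ for all $x_1,\ldots,x_n,z\in X$, where $d(x_1,\ldots,x_n)_i^z$ denotes the value obtained from $d(x_1,\ldots,x_n)$ by replacing its $i$th argument by $z$. The best constant associated with an $n$-distance $d$ on $X$ is $$K^*_n=\sup\left\{\frac{d(x_1,\ldots,x_n)}{\sum_{i=1}^n d(x_1,\ldots,x_n)_i^z}: x_1,\ldots,x_n,z\in X,\ |\{x_1,\ldots,x_n\}|\geq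 2\right\}.$$ *)

theory Defs
  imports "HOL-Analysis.Analysis" "HOL-Combinatorics.Permutations"
begin

section \<open>n-distances and their best constants\<close>

text \<open>Elements of \<open>X\<^sup>n\<close> are lists of length \<open>n\<close> over \<open>X\<close>; arguments are numbered from \<open>0\<close>,
  and \<open>xs[i := z]\<close> replaces the \<open>i\<close>th argument by \<open>z\<close>.\<close>

definition tuples :: "nat \<Rightarrow> 'a set \<Rightarrow> 'a list set" where
  "tuples n X = {xs. length xs = n \<and> set xs \<subseteq> X}"

definition n_distance :: "nat \<Rightarrow> 'a set \<Rightarrow> ('a list \<Rightarrow> real) \<Rightarrow> bool" where
  "n_distance n X d \<longleftrightarrow>
     n \<ge> 2 \<and> (\<exists>x\<in>X. \<exists>y\<in>X. x \<noteq> y) \<and>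
     (\<forall>xs \<in> tuples n X. d xs \<ge> 0) \<and>
     (\<forall>xs \<in> tuples n X. d xs = 0 \<longleftrightarrow> (\<forall>i<n. \<forall>j<n. xs ! i = xs ! j)) \<and>
     (\<forall>xs \<in> tuples n X. \<forall>p. p permutes {..<n} \<longrightarrow> d (permute_list p xs) = d xs) \<and>
     (\<forall>xs \<in> tuples n X. \<forall>z \<in> X. d xs \<le> (\<Sum>i<n. d (xs[i := z])))"

definition constant_ratios :: "nat \<Rightarrow> 'a set \<Rightarrow> ('a list \<Rightarrow> real) \<Rightarrow> real set" where
  "constant_ratios n X d =
     {d xs / (\<Sum>i<n. d (xs[i := z])) | xs z. xs \<in> tuples n X \<and> z \<in> X \<and> card (set xs) \<ge> 2}"

definition best_constant :: "nat \<Rightarrow> 'a set \<Rightarrow> ('a list \<Rightarrow> real) \<Rightarrow> real" where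
  "best_constant n X d = Sup (constant_ratios n X d)"

text \<open>For an n-distance, no denominator vanishes and the supremum is that of a nonempty set
  bounded above by \<open>1\<close>, so the real-valued \<open>Sup\<close> is a genuine least upper bound.\<close>

lemma constant_ratio_denominator_pos:
  assumes "n_distance n X d" "xs \<in> tuples n X" "z \<in> X" "card (set xs) \<ge> 2"
  shows "(\<Sum>i<n. d (xs[i := z])) > 0"
proof -
  have "\<not> (\<forall>i<n. \<forall>j<n. xs ! i = xs ! j)"
  proof
    assume *: "\<forall>i<n. \<forall>j<n. xs ! i = xs ! j"
    have "set xs \<subseteq> {xs ! 0}"
    proof
      fix x assume "x \<in> set xs"
      then obtain i where i: "i < length xs" "x = xs ! i"
        by (metis in_set_conv_nth)
      then have "i < n" "0 < n"
        using assms(2) by (auto simp: tuples_def)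
      with * i(2) show "x \<in> {xs ! 0}" by blast
    qed
    then have "card (set xs) \<le> 1"
      using card_mono[of "{xs ! 0}" "set xs"] by simp
    with assms(4) show False by simp
  qed
  with assms(1,2) have "d xs \<noteq> 0" "d xs \<ge> 0"
    unfolding n_distance_def by blast+
  moreover have "d xs \<le> (\<Sum>i<n. d (xs[i := z]))"
    using assms(1-3) unfolding n_distance_def by blast
  ultimately show ?thesis by linarith
qed

lemma constant_ratios_bdd_above:
  assumes "n_distance n X d"
  shows "bdd_above (constant_ratios n X d)"
proof (rule bdd_aboveI[of _ 1])
  fix r assume "r \<in> constant_ratios n X d"
  then obtain xs z where *: "xs \<in> tuples n X" "z \<in> X" "card (set xs) \<ge> 2"
    and r: "r = d xs / (\<Sum>i<n. d (xs[i := z]))"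
    unfolding constant_ratios_def by blast
  have "d xs \<le> (\<Sum>i<n. d (xs[i := z]))"
    using assms * unfolding n_distance_def by blast
  with constant_ratio_denominator_pos[OF assms *] show "r \<le> 1"
    unfolding r by simp
qed

lemma constant_ratios_nonempty:
  assumes "n_distance n X d"
  shows "constant_ratios n X d \<noteq> {}"
proof -
  obtain x y where xy: "x \<in> X" "y \<in> X" "x \<noteq> y" and n: "n \<ge> 2"
    using assms unfolding n_distance_def by blast
  define xs where "xs = x # replicate (n - 1) y"
  have "set xs = {x, y}" "length xs = n"
    using n by (auto simp: xs_def)
  then have "xs \<in> tuples n X" "card (set xs) \<ge> 2"
    using xy by (auto simp: tuples_def)
  with xy(1) show ?thesis
    unfolding constant_ratios_def by blast
qed


section \<open>Minimal spanning trees of complete Euclidean graphs\<close>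

text \<open>Simple graphs are given by a vertex set \<open>V\<close> and a set \<open>E\<close> of two-element subsets of \<open>V\<close>;
  a spanning tree is identified with its edge set.\<close>

definition complete_graph_edges :: "'a set \<Rightarrow> 'a set set" where
  "complete_graph_edges V = {{u, v} | u v. u \<in> V \<and> v \<in> V \<and> u \<noteq> v}"

definition graph_connected :: "'a set \<Rightarrow> 'a set set \<Rightarrow> bool" where
  "graph_connected V E \<longleftrightarrow> (\<forall>u\<in>V. \<forall>v\<in>V. (\<lambda>a b. {a, b} \<in> E)\<^sup>*\<^sup>* u v)"

text \<open>A cycle is given by its successive, pairwise distinct vertices (the first one is not
  repeated at the end).\<close>

definition graph_cycle :: "'a set set \<Rightarrow> 'a list \<Rightarrow> bool" where
  "graph_cycle E vs \<longleftrightarrow>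
     length vs \<ge> 3 \<and> distinct vs \<and>
     (\<forall>i<length vs. {vs ! i, vs ! (Suc i mod length vs)} \<in> E)"

definition spanning_tree :: "'a set \<Rightarrow> 'a set set \<Rightarrow> 'a set set \<Rightarrow> bool" where
  "spanning_tree V E T \<longleftrightarrow> T \<subseteq> E \<and> graph_connected V T \<and> (\<nexists>vs. graph_cycle T vs)"

definition edge_length :: "'a::metric_space set \<Rightarrow> real" where
  "edge_length e = (THE l. \<exists>u v. e = {u, v} \<and> l = dist u v)"

definition total_length :: "'a::metric_space set set \<Rightarrow> real" where
  "total_length T = (\<Sum>e\<in>T. edge_length e)"

lemma edge_length_doubleton [simp]: "edge_length {u, v} = dist u v"
  unfolding edge_length_def by (rule the_equality) (auto simp: doubleton_eq_iff dist_commute)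

definition minimal_spanning_tree ::
    "'a::metric_space set \<Rightarrow> 'a set set \<Rightarrow> 'a set set \<Rightarrow> bool" where
  "minimal_spanning_tree V E T \<longleftrightarrow>
     spanning_tree V E T \<and> (\<forall>T'. spanning_tree V E T' \<longrightarrow> total_length T \<le> total_length T')"

text \<open>All minimal spanning trees have the same total length, so the choice below is immaterial.
  The vertex set is the set of entries of \<open>xs\<close>, so repeated points give a single vertex.\<close>

definition mst_length :: "'a::metric_space list \<Rightarrow> real" where
  "mst_length xs =
     total_length (SOME T. minimal_spanning_tree (set xs) (complete_graph_edges (set xs)) T)"

end

theory Submission
  imports Defs
begin

text \<open>
  Write \<open>x\<^sub>0, \<dots>, x\<^sub>n\<^sub>-\<^sub>1\<close> for the arguments, \<open>M\<close> for the value of \<open>d\<close> on them, \<open>T\<^sub>i\<close> for the value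
  after \<open>x\<^sub>i\<close> has been replaced by \<open>z\<close>, and \<open>r\<^sub>j\<close> for the distance from \<open>z\<close> to \<open>x\<^sub>j\<close>.  The bound
  \<open>n M \<le> 2 (T\<^sub>0 + \<dots> + T\<^sub>n\<^sub>-\<^sub>1)\<close> holds in every metric space and comes from
  \<open>M + r\<^sub>j \<le> 2 T\<^sub>i + r\<^sub>i\<close> for all \<open>i \<noteq> j\<close> (lemma \<open>mst_of_le_twice_upd\<close>): summed over all
  pairs, the distances \<open>r\<close> cancel.

  To see the inequality, take a minimal tree for the modified points.  Delete the edges at \<open>z\<close>
  and reconnect the orphaned neighbours of \<open>z\<close>, together with \<open>x\<^sub>i\<close>, by a star centred at the one
  of them that is nearest to \<open>z\<close>.  By the triangle inequality through \<open>z\<close> the new star costs at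
  most twice the deleted edges, plus \<open>r\<^sub>i\<close>, minus the length of any single deleted edge
  \<open>{z, p}\<close>.  Choosing \<open>p\<close> as the neighbour through which the tree reaches \<open>x\<^sub>j\<close>, the saved
  length is at least \<open>r\<^sub>j\<close> minus the length of the edges that were kept.

  Strictness at a single configuration (\<open>mst_of_times_less\<close>): equality forces
  \<open>M + r\<^sub>j = 2 T\<^sub>i + r\<^sub>i\<close> for all \<open>i \<noteq> j\<close>.  For \<open>n \<ge> 3\<close> all \<open>r\<^sub>j\<close> are then equal, and
  tightness of the star construction centred at \<open>x\<^sub>i\<close> makes every other \<open>x\<^sub>j\<close> the reflection of
  \<open>x\<^sub>i\<close> in \<open>z\<close>; this uses the strict convexity of the Euclidean norm.  With three indices
  at hand, all points coincide.

  The supremum is strictly smaller than \<open>2 / n\<close> because it is governed by a maximum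
  (\<open>mst_of_uniform_bound\<close>): the ratio is invariant under translations and dilations, so one may
  take \<open>z = 0\<close> and norms summing to \<open>1\<close>, and it is continuous on this compact set.

  Both the replacement of \<open>x\<^sub>i\<close> and the limits of configurations may make points coincide.  To avoid
  case distinctions, graphs live on the set of positions \<open>{..<n}\<close> instead of the set of points,
  with a map \<open>f\<close> from positions to points.  Then \<open>M\<close> is the minimum, over the finitely many
  connected graphs on \<open>{..<n}\<close>, of a cost that depends continuously on \<open>f\<close>
  (\<open>mst_of_eq_Min\<close>).
\<close>

section \<open>Reachability and spanning trees\<close>

abbreviation reaches :: "'a set set \<Rightarrow> 'a \<Rightarrow> 'a \<Rightarrow> bool" where
  "reaches E \<equiv> (\<lambda>a b. {a, b} \<in> E)\<^sup>*\<^sup>*"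

lemma reaches_sym: "reaches E u v \<Longrightarrow> reaches E v u"
proof (induction rule: rtranclp_induct)
  case (step y z)
  then show ?case
    by (metis (no_types, lifting) converse_rtranclp_into_rtranclp insert_commute)
qed simp

lemma reaches_simulate:
  assumes "reaches E u v" and "\<And>a b. {a, b} \<in> E \<Longrightarrow> reaches F (h a) (h b)"
  shows "reaches F (h u) (h v)"
  using assms(1)
proof (induction rule: rtranclp_induct)
  case (step y z)
  then show ?case using assms(2) by (meson rtranclp_trans)
qed simp

text \<open>The vertex \<open>p\<close> follows the last visit of \<open>i\<close> on a walk to \<open>j\<close>.  Cutting walks here
  replaces any appeal to simple paths.\<close>

lemma reaches_last_exit:
  assumes "reaches G i j" "j \<noteq> i"
  obtains p where "{i, p} \<in> G" "p \<noteq> i" "reaches {e \<in> G. i \<notin> e} p j"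
proof -
  have "j = i \<or> (\<exists>p. {i, p} \<in> G \<and> p \<noteq> i \<and> reaches {e \<in> G. i \<notin> e} p j)"
    using assms(1)
  proof (induction rule: rtranclp_induct)
    case (step y w)
    show ?case
    proof (cases "w = i \<or> y = i")
      case True
      then show ?thesis using step.hyps(2) by auto
    next
      case False
      then obtain p where p: "{i, p} \<in> G" "p \<noteq> i" "reaches {e \<in> G. i \<notin> e} p y"
        using step.IH by blast
      have "{y, w} \<in> {e \<in> G. i \<notin> e}" using False step.hyps(2) by auto
      with p(3) have "reaches {e \<in> G. i \<notin> e} p w"
        by (rule rtranclp.rtrancl_into_rtrancl)
      with p show ?thesis by blast
    qed
  qed simp
  with assms(2) that show thesis by blast
qed

lemma doubleton_complete_graph_edges [simp]:
  "{u, v} \<in> complete_graph_edges V \<longleftrightarrow> u \<in> V \<and> v \<in> V \<and> u \<noteq> v"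
  unfolding complete_graph_edges_def by (auto simp: doubleton_eq_iff)

lemma singleton_complete_graph_edges [simp]: "{u} \<notin> complete_graph_edges V"
  using doubleton_complete_graph_edges[of u u V] by simp

lemma edge_length_singleton [simp]: "edge_length {u} = 0"
  using edge_length_doubleton[of u u] by simp

lemma complete_graph_edgesE:
  assumes "e \<in> complete_graph_edges V"
  obtains u v where "u \<in> V" "v \<in> V" "u \<noteq> v" "e = {u, v}"
  using assms unfolding complete_graph_edges_def by blast

lemma finite_complete_graph_edges: "finite V \<Longrightarrow> finite (complete_graph_edges V)"
  by (rule finite_subset[of _ "Pow V"]) (auto simp: complete_graph_edges_def)

lemma graph_connected_complete: "graph_connected V (complete_graph_edges V)"
  unfolding graph_connected_def
proof (intro ballI)
  fix u v assume uv: "u \<in> V" "v \<in> V"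
  show "reaches (complete_graph_edges V) u v"
  proof (cases "u = v")
    case False
    with uv have "{u, v} \<in> complete_graph_edges V"
      by (auto simp: complete_graph_edges_def)
    then show ?thesis by (rule r_into_rtranclp)
  qed simp
qed

text \<open>The edge between the first two vertices of a cycle can be bypassed along the rest of the
  cycle.\<close>

lemma connected_remove_cycle_edge:
  assumes conn: "graph_connected V T" and cyc: "graph_cycle T vs"
  shows "\<exists>e\<in>T. graph_connected V (T - {e})"
proof -
  define k where "k = length vs"
  define e where "e = {vs ! 0, vs ! 1}"
  have k: "k \<ge> 3" and dis: "distinct vs"
    and edge: "\<And>i. i < k \<Longrightarrow> {vs ! i, vs ! (Suc i mod k)} \<in> T"
    using cyc by (auto simp: graph_cycle_def k_def)
  have eq: "vs ! i = vs ! j \<longleftrightarrow> i = j" if "i < k" "j < k" for i j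
    using that dis by (simp add: k_def nth_eq_iff_index_eq)
  have eT: "e \<in> T" using edge[of 0] k by (simp add: e_def)
  have along: "reaches (T - {e}) (vs ! 1) (vs ! i)" if "1 \<le> i" "i < k" for i
    using that
  proof (induction i rule: dec_induct)
    case (step m)
    then have "{vs ! m, vs ! Suc m} \<in> T" using edge[of m] by simp
    (* The cycle has length at least 3, so no later edge runs back along e. *)
    moreover have "{vs ! m, vs ! Suc m} \<noteq> e"
      using step k eq[of m 0] eq[of m 1] eq[of "Suc m" 1] eq[of "Suc m" 0]
      by (auto simp: e_def doubleton_eq_iff)
    ultimately have "{vs ! m, vs ! Suc m} \<in> T - {e}" by blast
    then show ?case using step by (meson Suc_lessD rtranclp.rtrancl_into_rtrancl)
  qed simp
  have "{vs ! (k - 1), vs ! 0} \<in> T" using edge[of "k - 1"] k by simp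
  moreover have "{vs ! (k - 1), vs ! 0} \<noteq> e"
    using k eq[of "k - 1" 0] eq[of "k - 1" 1] eq[of 0 1]
    by (auto simp: e_def doubleton_eq_iff)
  ultimately have "{vs ! (k - 1), vs ! 0} \<in> T - {e}" by blast
  moreover have "reaches (T - {e}) (vs ! 1) (vs ! (k - 1))"
    using along[of "k - 1"] k by simp
  ultimately have bypass: "reaches (T - {e}) (vs ! 1) (vs ! 0)"
    by (rule rtranclp.rtrancl_into_rtrancl[rotated])
  have "reaches (T - {e}) u v" if "u \<in> V" "v \<in> V" for u v
  proof -
    have "reaches T u v" using conn that by (auto simp: graph_connected_def)
    moreover have "reaches (T - {e}) a b" if "{a, b} \<in> T" for a b
    proof (cases "{a, b} = e")
      case True
      then show ?thesis using bypass reaches_sym[OF bypass]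
        by (auto simp: e_def doubleton_eq_iff)
    next
      case False
      with that have "{a, b} \<in> T - {e}" by blast
      then show ?thesis by (rule r_into_rtranclp)
    qed
    ultimately show ?thesis using reaches_simulate[where h = "\<lambda>x. x"] by metis
  qed
  with eT show ?thesis by (auto simp: graph_connected_def)
qed

text \<open>An inclusion-minimal connected set of edges has no cycle, since a cycle would contain a
  removable edge.  Through this, connected graphs can take the place of trees in all that follows.\<close>

lemma connected_imp_spanning_tree:
  assumes "finite E" "graph_connected V E"
  shows "\<exists>T. spanning_tree V E T"
proof -
  have "finite {T \<in> Pow E. graph_connected V T}" "{T \<in> Pow E. graph_connected V T} \<noteq> {}"
    using assms by auto
  from finite_has_minimal[OF this] obtain T
    where T: "T \<subseteq> E" "graph_connected V T"
      and min: "\<And>S. S \<subseteq> E \<Longrightarrow> graph_connected V S \<Longrightarrow> S \<subseteq> T \<Longrightarrow> T = S"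
    by auto
  have "\<nexists>vs. graph_cycle T vs"
  proof
    assume "\<exists>vs. graph_cycle T vs"
    then obtain e where "e \<in> T" "graph_connected V (T - {e})"
      using connected_remove_cycle_edge[OF T(2)] by blast
    with min[of "T - {e}"] T(1) show False by blast
  qed
  with T show ?thesis by (auto simp: spanning_tree_def)
qed

lemma edge_length_nonneg: "e \<in> complete_graph_edges V \<Longrightarrow> 0 \<le> edge_length e"
  by (auto simp: complete_graph_edges_def)

lemma mst_length_attained:
  obtains T where "minimal_spanning_tree (set xs) (complete_graph_edges (set xs)) T"
    "mst_length xs = total_length T"
proof -
  let ?E = "complete_graph_edges (set xs)"
  let ?S = "{T. spanning_tree (set xs) ?E T}"
  have fin: "finite ?E" by (simp add: finite_complete_graph_edges)
  have "finite ?S"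
    by (rule finite_subset[of _ "Pow ?E"]) (use fin in \<open>auto simp: spanning_tree_def\<close>)
  moreover have "?S \<noteq> {}"
    using connected_imp_spanning_tree[OF fin graph_connected_complete] by blast
  ultimately have "\<exists>T\<in>?S. \<forall>T'\<in>?S. total_length T \<le> total_length T'"
    by (metis (no_types, lifting) arg_min_if_finite(1) arg_min_least)
  then have "\<exists>T. minimal_spanning_tree (set xs) ?E T"
    by (auto simp: minimal_spanning_tree_def)
  then have "minimal_spanning_tree (set xs) ?E (SOME T. minimal_spanning_tree (set xs) ?E T)"
    by (rule someI_ex)
  then show thesis using that by (simp add: mst_length_def)
qed

lemma mst_length_le_connected:
  assumes E: "E \<subseteq> complete_graph_edges (set xs)" and conn: "graph_connected (set xs) E"
  shows "mst_length xs \<le> total_length E"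
proof -
  have fin: "finite E" using E finite_complete_graph_edges finite_subset by blast
  obtain S where S: "spanning_tree (set xs) E S"
    using connected_imp_spanning_tree[OF fin conn] by blast
  obtain T where T: "minimal_spanning_tree (set xs) (complete_graph_edges (set xs)) T"
    "mst_length xs = total_length T" by (rule mst_length_attained)
  have "spanning_tree (set xs) (complete_graph_edges (set xs)) S"
    using S E by (auto simp: spanning_tree_def)
  then have "total_length T \<le> total_length S"
    using T(1) by (auto simp: minimal_spanning_tree_def)
  also have "\<dots> \<le> total_length E"
    unfolding total_length_def
    by (rule sum_mono2) (use fin S E edge_length_nonneg in \<open>auto simp: spanning_tree_def\<close>)
  finally show ?thesis using T(2) by simp
qed

section \<open>Graphs on the set of argument positions\<close>

text \<open>Two positions may carry the same point, so the edge between them then has the singleton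
  image \<open>{u}\<close>, whose length is \<open>0\<close>.  Repeated arguments are thus joined for free.\<close>

definition connected_graphs :: "'a set \<Rightarrow> 'a set set set" where
  "connected_graphs I = {G. G \<subseteq> complete_graph_edges I \<and> graph_connected I G}"

definition span_cost :: "('i \<Rightarrow> 'a::metric_space) \<Rightarrow> 'i set set \<Rightarrow> real" where
  "span_cost f G = (\<Sum>e\<in>G. edge_length (f ` e))"

abbreviation mst_of :: "nat \<Rightarrow> (nat \<Rightarrow> 'a::metric_space) \<Rightarrow> real" where
  "mst_of n f \<equiv> mst_length (map f [0..<n])"

lemma edge_length_image_nonneg:
  "e \<in> complete_graph_edges I \<Longrightarrow> 0 \<le> edge_length (f ` e)"
  by (auto simp: complete_graph_edges_def)

lemma finite_graph: "finite I \<Longrightarrow> G \<subseteq> complete_graph_edges I \<Longrightarrow> finite G"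
  using finite_complete_graph_edges finite_subset by blast

text \<open>The images of the edges connect the points.  Those that degenerate to singletons are
  dropped, and several edges may have the same image, so the cost can only decrease.\<close>

lemma mst_of_le_span_cost:
  assumes G: "G \<in> connected_graphs {..<n}"
  shows "mst_of n f \<le> span_cost f G"
proof -
  let ?xs = "map f [0..<n]"
  define H where "H = {e \<in> G. f ` e \<in> complete_graph_edges (set ?xs)}"
  have GE: "G \<subseteq> complete_graph_edges {..<n}" and conn: "graph_connected {..<n} G"
    using G by (auto simp: connected_graphs_def)
  have finG: "finite G" using GE finite_graph by blast
  have "graph_connected (set ?xs) ((`) f ` H)"
    unfolding graph_connected_def
  proof (intro ballI)
    fix u v assume "u \<in> set ?xs" "v \<in> set ?xs"
    then obtain i j where ij: "i < n" "j < n" "u = f i" "v = f j" by auto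
    have "reaches G i j" using conn ij by (auto simp: graph_connected_def)
    then have "reaches ((`) f ` H) (f i) (f j)"
    proof (rule reaches_simulate)
      fix a b assume ab: "{a, b} \<in> G"
      show "reaches ((`) f ` H) (f a) (f b)"
      proof (cases "f a = f b")
        case False
        have "{a, b} \<in> complete_graph_edges {..<n}" using ab GE by blast
        then have "f ` {a, b} \<in> complete_graph_edges (set ?xs)"
          using False by simp
        with ab have "f ` {a, b} \<in> (`) f ` H" unfolding H_def by blast
        then have "{f a, f b} \<in> (`) f ` H" by simp
        then show ?thesis by (rule r_into_rtranclp)
      qed simp
    qed
    with ij show "reaches ((`) f ` H) u v" by simp
  qed
  then have "mst_length ?xs \<le> total_length ((`) f ` H)"
    by (intro mst_length_le_connected) (auto simp: H_def)
  also have "\<dots> \<le> (\<Sum>e\<in>H. edge_length (f ` e))"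
    unfolding total_length_def
    by (rule sum_image_le[of H edge_length "(`) f", unfolded o_def])
      (use finG GE edge_length_image_nonneg[of _ "{..<n}"] in \<open>auto simp: H_def\<close>)
  also have "\<dots> \<le> span_cost f G"
    unfolding span_cost_def
    by (rule sum_mono2) (use finG GE edge_length_image_nonneg[of _ "{..<n}"] in \<open>auto simp: H_def\<close>)
  finally show ?thesis .
qed

text \<open>A minimal spanning tree on the points lifts to the positions by choosing one position
  \<open>s v\<close> for each point \<open>v\<close>; every other position is attached, at no cost, to the chosen
  position of the same point.\<close>

lemma span_cost_attained:
  obtains G where "G \<in> connected_graphs {..<n}" "span_cost f G = mst_of n f"
proof -
  let ?xs = "map f [0..<n]"
  obtain T where T: "minimal_spanning_tree (set ?xs) (complete_graph_edges (set ?xs)) T"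
    "mst_length ?xs = total_length T" by (rule mst_length_attained)
  have TE: "T \<subseteq> complete_graph_edges (set ?xs)" and Tc: "graph_connected (set ?xs) T"
    using T(1) by (auto simp: minimal_spanning_tree_def spanning_tree_def)
  have finT: "finite T" using TE finite_graph by blast
  have "\<forall>v\<in>set ?xs. \<exists>i<n. f i = v" by auto
  then obtain s where s: "\<And>v. v \<in> set ?xs \<Longrightarrow> s v < n \<and> f (s v) = v" by metis
  define P where "P = {{i, s (f i)} | i. i < n \<and> i \<noteq> s (f i)}"
  define G where "G = (`) s ` T \<union> P"
  have fs: "f ` s ` e = e" if eT: "e \<in> T" for e
  proof -
    obtain u v where "u \<in> set ?xs" "v \<in> set ?xs" "e = {u, v}"
      using subsetD[OF TE eT] by (rule complete_graph_edgesE)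
    then show ?thesis using s by simp
  qed
  have P0: "edge_length (f ` e) = 0" if "e \<in> P" for e
    using that s by (auto simp: P_def)
  have "P \<subseteq> (\<lambda>i. {i, s (f i)}) ` {..<n}" unfolding P_def by blast
  then have finP: "finite P" by (rule finite_subset) simp
  have GE: "G \<subseteq> complete_graph_edges {..<n}"
  proof
    fix e assume "e \<in> G"
    then consider e' where "e' \<in> T" "e = s ` e'" | "e \<in> P" by (auto simp: G_def)
    then show "e \<in> complete_graph_edges {..<n}"
    proof cases
      case 1
      from subsetD[OF TE 1(1)] obtain u v
        where "u \<in> set ?xs" "v \<in> set ?xs" "u \<noteq> v" "e' = {u, v}"
        by (rule complete_graph_edgesE)
      with 1 have uv: "u \<in> set ?xs" "v \<in> set ?xs" "u \<noteq> v" "e = {s u, s v}" by auto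
      moreover have "s u \<noteq> s v" using s uv by metis
      ultimately show ?thesis using s[of u] s[of v] by simp
    next
      case 2
      then show ?thesis using s by (auto simp: P_def)
    qed
  qed
  have home: "reaches G i (s (f i))" if "i < n" for i
  proof (cases "i = s (f i)")
    case False
    with that have "{i, s (f i)} \<in> G" by (auto simp: G_def P_def)
    then show ?thesis by (rule r_into_rtranclp)
  qed simp
  have "reaches G i j" if "i < n" "j < n" for i j
  proof -
    have "reaches T (f i) (f j)" using Tc that by (auto simp: graph_connected_def)
    then have "reaches G (s (f i)) (s (f j))"
    proof (rule reaches_simulate)
      fix a b assume "{a, b} \<in> T"
      then have "s ` {a, b} \<in> G" unfolding G_def by blast
      then have "{s a, s b} \<in> G" by simp
      then show "reaches G (s a) (s b)" by (rule r_into_rtranclp)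
    qed
    then have "reaches G i (s (f j))" by (rule rtranclp_trans[OF home[OF that(1)]])
    then show ?thesis using reaches_sym[OF home[OF that(2)]] by (rule rtranclp_trans)
  qed
  then have G: "G \<in> connected_graphs {..<n}"
    using GE by (auto simp: connected_graphs_def graph_connected_def)
  have "span_cost f G \<le> (\<Sum>e\<in>(`) s ` T. edge_length (f ` e)) + (\<Sum>e\<in>P. edge_length (f ` e))"
    unfolding span_cost_def G_def
    using finT finP sum_nonneg[of "(`) s ` T \<inter> P" "\<lambda>e. edge_length (f ` e)"] P0
    by (subst sum_Un) auto
  also have "\<dots> = (\<Sum>e\<in>(`) s ` T. edge_length (f ` e))"
    using P0 by simp
  also have "\<dots> = (\<Sum>e\<in>T. edge_length (f ` s ` e))"
  proof -
    have "inj_on ((`) s) T" using fs by (metis inj_onI)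
    then show ?thesis by (simp add: sum.reindex)
  qed
  also have "\<dots> = mst_of n f" using fs T(2) by (simp add: total_length_def)
  finally show thesis using that[OF G] mst_of_le_span_cost[OF G, of f] by simp
qed

lemma finite_connected_graphs: "finite (connected_graphs {..<n::nat})"
  by (rule finite_subset[of _ "Pow (complete_graph_edges {..<n})"])
    (auto simp: connected_graphs_def finite_complete_graph_edges)

lemma mst_of_eq_Min: "mst_of n f = Min (span_cost f ` connected_graphs {..<n})"
proof -
  obtain G where "G \<in> connected_graphs {..<n}" "span_cost f G = mst_of n f"
    by (rule span_cost_attained)
  then have "mst_of n f \<in> span_cost f ` connected_graphs {..<n}"
    by (metis imageI)
  then show ?thesis
    using mst_of_le_span_cost[of _ n f] finite_connected_graphs[of n]
    by (intro Min_eqI[symmetric]) auto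
qed

section \<open>Replacing one argument\<close>

text \<open>Induction on the number of edges: after the last visit of \<open>i\<close>, no edge at \<open>i\<close> is used
  any more, so the first edge of the remaining walk is not counted twice.\<close>

lemma dist_le_span_cost:
  assumes "finite I" "G \<subseteq> complete_graph_edges I" "reaches G i j"
  shows "dist (f i) (f j) \<le> span_cost f G"
  using assms
proof (induction "card G" arbitrary: G i rule: less_induct)
  case less
  have finG: "finite G" using less.prems finite_graph by blast
  have nonneg: "0 \<le> span_cost f G'" if "G' \<subseteq> G" for G'
    unfolding span_cost_def
    using that less.prems(2) edge_length_image_nonneg by (intro sum_nonneg) blast
  show ?case
  proof (cases "j = i")
    case True
    then show ?thesis using nonneg by simp
  next
    case False
    let ?H = "{e \<in> G. i \<notin> e}"
    obtain p where p: "{i, p} \<in> G" "p \<noteq> i" "reaches ?H p j"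
      using less.prems(3) False by (rule reaches_last_exit)
    have "{i, p} \<notin> ?H" by simp
    with p(1) have "?H \<noteq> G" by metis
    then have "?H \<subset> G" by blast
    then have "card ?H < card G" using finG by (rule psubset_card_mono[rotated])
    then have "dist (f p) (f j) \<le> span_cost f ?H"
      using less.hyps[of ?H p] less.prems(1,2) p(3) by blast
    then have "dist (f i) (f j) \<le> edge_length (f ` {i, p}) + span_cost f ?H"
      using dist_triangle[of "f i" "f j" "f p"] by simp
    also have "\<dots> = span_cost f (insert {i, p} ?H)"
      unfolding span_cost_def using finG by simp
    also have "\<dots> \<le> span_cost f G"
      unfolding span_cost_def
    proof (rule sum_mono2[OF finG])
      show "insert {i, p} ?H \<subseteq> G" using p(1) by blast
      show "0 \<le> edge_length (f ` e)" if "e \<in> G - insert {i, p} ?H" for e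
        using that less.prems(2) by (intro edge_length_image_nonneg[of _ I]) blast
    qed
    finally show ?thesis .
  qed
qed

text \<open>The positions in \<open>Y\<close> are the neighbours orphaned by the removal of \<open>z\<close>.  The centre \<open>m\<close>
  is the position in \<open>insert i Y\<close> closest to \<open>z\<close>: every spoke makes a detour through \<open>z\<close>, so
  that the distance \<open>r m\<close> is paid once per spoke.  One of these payments makes up for the
  missing spoke at \<open>m\<close> itself; as \<open>r m\<close> is the smallest distance, the others can be charged to
  different elements of \<open>Y\<close> other than \<open>p\<close>.\<close>

lemma star_centre:
  fixes z :: "'a::metric_space"
  assumes "finite Y" "p \<in> Y"
  shows "\<exists>m\<in>insert i Y. (\<Sum>w\<in>insert i Y. dist (f m) (f w))
     \<le> 2 * (\<Sum>y\<in>Y. dist z (f y)) - dist z (f p) + dist z (f i)"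
proof -
  define r where "r w = dist z (f w)" for w
  define S where "S = (\<Sum>y\<in>Y. r y)"
  have dr: "dist (f a) (f b) \<le> r b + r a" for a b
    unfolding r_def by (metis add.commute dist_commute dist_triangle)
  obtain m where m: "m \<in> Y" "\<And>y. y \<in> Y \<Longrightarrow> r m \<le> r y"
    using assms by (metis arg_min_if_finite(1) arg_min_least empty_iff)
  (* A distance not exceeding any r y can be charged to every y except p. *)
  have least: "(real (card Y) - 1) * c \<le> S - r p" if "\<And>y. y \<in> Y \<Longrightarrow> c \<le> r y" for c
  proof -
    have "(real (card Y) - 1) * c = (\<Sum>y\<in>Y - {p}. c)"
    proof -
      have "card Y \<ge> 1" using assms by (metis One_nat_def Suc_leI card_gt_0_iff empty_iff)
      then show ?thesis using assms by (simp add: of_nat_diff)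
    qed
    also have "\<dots> \<le> (\<Sum>y\<in>Y - {p}. r y)" using that by (intro sum_mono) auto
    also have "\<dots> = S - r p" using assms by (simp add: S_def sum_diff1)
    finally show ?thesis .
  qed
  have "\<exists>m\<in>insert i Y. (\<Sum>w\<in>insert i Y. dist (f m) (f w)) \<le> 2 * S - r p + r i"
  proof (cases "r i \<le> r m")
    case True
    have "(\<Sum>w\<in>insert i Y. dist (f i) (f w)) = (\<Sum>w\<in>Y. dist (f i) (f w))"
      using assms by (cases "i \<in> Y") (auto simp: insert_absorb)
    also have "\<dots> \<le> (\<Sum>w\<in>Y. r w + r i)" by (intro sum_mono dr)
    also have "\<dots> = S + (real (card Y) - 1) * r i + r i"
      by (simp add: sum.distrib S_def algebra_simps)
    finally show ?thesis
      using least[of "r i"] True m(2) by (intro bexI[of _ i]) force+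
  next
    case False
    have "(\<Sum>w\<in>insert i Y. dist (f m) (f w)) \<le> dist (f m) (f i) + (\<Sum>w\<in>Y. dist (f m) (f w))"
      using assms by (cases "i \<in> Y") (auto simp: insert_absorb)
    also have "(\<Sum>w\<in>Y. dist (f m) (f w)) = (\<Sum>w\<in>Y - {m}. dist (f m) (f w))"
      using sum.remove[OF assms(1) m(1), of "\<lambda>w. dist (f m) (f w)"] by simp
    also have "\<dots> \<le> (\<Sum>w\<in>Y - {m}. r w + r m)" by (intro sum_mono dr)
    also have "\<dots> = (\<Sum>w\<in>Y. r w + r m) - 2 * r m"
      using assms m(1) by (simp add: sum_diff1)
    also have "\<dots> = S + (real (card Y) - 1) * r m - r m"
      by (simp add: sum.distrib S_def algebra_simps)
    finally show ?thesis
      using least[of "r m"] m dr[of m i] by (intro bexI[of _ m]) auto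
  qed
  then show ?thesis by (simp add: r_def S_def)
qed

lemma span_cost_upd_split:
  assumes "finite I" "G \<subseteq> complete_graph_edges I"
  shows "span_cost (f(i := z)) G
    = span_cost f {e \<in> G. i \<notin> e} + (\<Sum>y\<in>{y. {i, y} \<in> G}. dist z (f y))"
proof -
  let ?H = "{e \<in> G. i \<notin> e}" and ?Y = "{y. {i, y} \<in> G}" and ?g = "f(i := z)"
  have finG: "finite G" using assms finite_graph by blast
  have "e \<in> (\<lambda>y. {i, y}) ` ?Y" if e: "e \<in> G" "i \<in> e" for e
  proof -
    obtain u v where uv: "e = {u, v}"
      using subsetD[OF assms(2) e(1)] by (rule complete_graph_edgesE)
    show ?thesis
    proof (cases "u = i")
      case False
      then have "e = {i, u}" using uv e(2) by auto
      then show ?thesis using e(1) by blast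
    qed (use uv e(1) in blast)
  qed
  then have split: "G = ?H \<union> (\<lambda>y. {i, y}) ` ?Y" by blast
  have iY: "i \<notin> ?Y" using subsetD[OF assms(2), of "{i, i}"] by auto
  have "span_cost ?g G = span_cost ?g ?H + span_cost ?g ((\<lambda>y. {i, y}) ` ?Y)"
    unfolding span_cost_def
    by (subst split, rule sum.union_disjoint) (use finG split in \<open>auto intro: finite_subset\<close>)
  also have "span_cost ?g ?H = span_cost f ?H"
    unfolding span_cost_def by (intro sum.cong arg_cong[of _ _ edge_length] image_cong) auto
  also have "span_cost ?g ((\<lambda>y. {i, y}) ` ?Y) = (\<Sum>y\<in>?Y. edge_length (?g ` {i, y}))"
    unfolding span_cost_def by (subst sum.reindex) (auto intro!: inj_onI simp: doubleton_eq_iff)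
  also have "\<dots> = (\<Sum>y\<in>?Y. dist z (f y))"
  proof (rule sum.cong)
    fix y assume "y \<in> ?Y"
    with iY have "?g ` {i, y} = {z, f y}" by auto
    then show "edge_length (?g ` {i, y}) = dist z (f y)" by simp
  qed simp
  finally show ?thesis .
qed

lemma finite_neighbours:
  assumes "finite I" "G \<subseteq> complete_graph_edges I"
  shows "finite {y. {i, y} \<in> G}" "{y. {i, y} \<in> G} \<subseteq> I"
proof -
  show "{y. {i, y} \<in> G} \<subseteq> I"
  proof
    fix y assume "y \<in> {y. {i, y} \<in> G}"
    then show "y \<in> I" using subsetD[OF assms(2), of "{i, y}"] by simp
  qed
  then show "finite {y. {i, y} \<in> G}" using assms(1) finite_subset by blast
qed

text \<open>An edge at \<open>i\<close> joins two of the positions that the star centred at \<open>m\<close> connects, so the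
  star can replace all the edges at \<open>i\<close>.  The term \<open>w = m\<close> of the sum vanishes.\<close>

lemma mst_of_le_recentred:
  assumes G: "G \<in> connected_graphs {..<n}" and i: "i < n" and m: "m \<in> insert i {y. {i, y} \<in> G}"
  shows "mst_of n f \<le> span_cost f {e \<in> G. i \<notin> e}
     + (\<Sum>w\<in>insert i {y. {i, y} \<in> G}. dist (f m) (f w))"
proof -
  let ?Y = "{y. {i, y} \<in> G}" and ?H = "{e \<in> G. i \<notin> e}"
  let ?W = "insert i ?Y"
  have GE: "G \<subseteq> complete_graph_edges {..<n}" and conn: "graph_connected {..<n} G"
    using G by (auto simp: connected_graphs_def)
  define St where "St = (\<lambda>w. {m, w}) ` (?W - {m})"
  have finY: "finite ?Y" and YI: "?Y \<subseteq> {..<n}" using finite_neighbours[OF _ GE, of i] by auto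
  have finH: "finite ?H" using finite_graph[OF _ GE] by simp
  have StE: "St \<subseteq> complete_graph_edges {..<n}"
    using m i YI by (auto simp: St_def)
  have hub: "reaches (?H \<union> St) m w" if "w \<in> ?W" for w
  proof (cases "w = m")
    case False
    with that have "{m, w} \<in> ?H \<union> St" by (auto simp: St_def)
    then show ?thesis by (rule r_into_rtranclp)
  qed simp
  have step: "reaches (?H \<union> St) a b" if "{a, b} \<in> G" for a b
  proof (cases "i \<in> {a, b}")
    case True
    with that have "a \<in> ?W" "b \<in> ?W" by (auto simp: insert_commute)
    then show ?thesis by (rule rtranclp_trans[OF reaches_sym[OF hub] hub])
  next
    case False
    with that have "{a, b} \<in> ?H \<union> St" by auto
    then show ?thesis by (rule r_into_rtranclp)
  qed
  have "graph_connected {..<n} (?H \<union> St)"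
    unfolding graph_connected_def
  proof (intro ballI)
    fix u v assume "u \<in> {..<n}" "v \<in> {..<n}"
    with conn have "reaches G u v" by (auto simp: graph_connected_def)
    then show "reaches (?H \<union> St) u v"
      using step reaches_simulate[where h = "\<lambda>x. x" and E = G] by blast
  qed
  then have "?H \<union> St \<in> connected_graphs {..<n}"
    using GE StE by (auto simp: connected_graphs_def)
  then have "mst_of n f \<le> span_cost f (?H \<union> St)" by (rule mst_of_le_span_cost)
  also have "\<dots> \<le> span_cost f ?H + span_cost f St"
  proof -
    have "0 \<le> (\<Sum>e\<in>?H \<inter> St. edge_length (f ` e))"
      using StE edge_length_image_nonneg by (intro sum_nonneg) blast
    then show ?thesis unfolding span_cost_def
      using finH finY by (subst sum_Un) (auto simp: St_def)
  qed
  also have "span_cost f St = (\<Sum>w\<in>?W - {m}. dist (f m) (f w))"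
    unfolding span_cost_def St_def
    by (subst sum.reindex) (auto intro!: inj_onI simp: doubleton_eq_iff)
  also have "\<dots> = (\<Sum>w\<in>?W. dist (f m) (f w))"
    using m finY by (intro sum.mono_neutral_left) auto
  finally show ?thesis by simp
qed

lemma nearby_neighbour:
  fixes f :: "nat \<Rightarrow> 'a::metric_space"
  assumes G: "G \<in> connected_graphs {..<n}" and ij: "i < n" "j < n" "j \<noteq> i"
  obtains p where "{i, p} \<in> G" "dist (f p) (f j) \<le> span_cost f {e \<in> G. i \<notin> e}"
proof -
  have "reaches G i j" using G ij by (auto simp: connected_graphs_def graph_connected_def)
  then obtain p where p: "{i, p} \<in> G" "reaches {e \<in> G. i \<notin> e} p j"
    using ij(3) by (rule reaches_last_exit)
  have "{e \<in> G. i \<notin> e} \<subseteq> complete_graph_edges {..<n}"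
    using G by (auto simp: connected_graphs_def)
  then have "dist (f p) (f j) \<le> span_cost f {e \<in> G. i \<notin> e}"
    using p(2) by (rule dist_le_span_cost[OF finite_lessThan, where f = f and i = p and j = j])
  with p(1) show thesis using that by blast
qed

text \<open>The central inequality.  Here \<open>A\<close> is the cost of the edges of an optimal graph for
  \<open>f(i := z)\<close> that avoid \<open>i\<close>; they survive when position \<open>i\<close> gets its point \<open>f i\<close> back.
  One copy of \<open>A\<close> is kept in the new graph, and a second copy pays for the way from \<open>f p\<close> to
  \<open>f j\<close>.\<close>

lemma mst_of_le_twice_upd:
  assumes ij: "i < n" "j < n" "j \<noteq> i"
  shows "mst_of n f + dist z (f j) \<le> 2 * mst_of n (f(i := z)) + dist z (f i)"
proof -
  obtain G where G: "G \<in> connected_graphs {..<n}" "span_cost (f(i := z)) G = mst_of n (f(i := z))"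
    by (rule span_cost_attained)
  have GE: "G \<subseteq> complete_graph_edges {..<n}" using G by (auto simp: connected_graphs_def)
  let ?Y = "{y. {i, y} \<in> G}"
  define A where "A = span_cost f {e \<in> G. i \<notin> e}"
  obtain p where p: "p \<in> ?Y" "dist (f p) (f j) \<le> A"
    using nearby_neighbour[OF G(1) ij, of f] by (auto simp: A_def)
  obtain m where m: "m \<in> insert i ?Y" "(\<Sum>w\<in>insert i ?Y. dist (f m) (f w))
     \<le> 2 * (\<Sum>y\<in>?Y. dist z (f y)) - dist z (f p) + dist z (f i)"
    using star_centre[OF finite_neighbours(1)[OF finite_lessThan GE] p(1)] by blast
  have "mst_of n f \<le> A + (\<Sum>w\<in>insert i ?Y. dist (f m) (f w))"
    unfolding A_def by (rule mst_of_le_recentred[OF G(1) ij(1) m(1)])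
  moreover have "dist z (f j) \<le> dist z (f p) + A"
    using p(2) dist_triangle[of z "f j" "f p"] by linarith
  moreover have "mst_of n (f(i := z)) = A + (\<Sum>y\<in>?Y. dist z (f y))"
    using span_cost_upd_split[OF finite_lessThan GE, of f i z] G(2) by (simp add: A_def)
  ultimately show ?thesis using m(2) by argo
qed

lemma span_cost_nonneg:
  "finite I \<Longrightarrow> G \<subseteq> complete_graph_edges I \<Longrightarrow> 0 \<le> span_cost f G"
  unfolding span_cost_def using edge_length_image_nonneg by (intro sum_nonneg) blast

lemma mst_of_nonneg: "0 \<le> mst_of n f"
proof -
  obtain G where "G \<in> connected_graphs {..<n}" "span_cost f G = mst_of n f"
    by (rule span_cost_attained)
  then show ?thesis using span_cost_nonneg[of "{..<n}" G f] by (simp add: connected_graphs_def)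
qed

lemma mst_of_eq_0_iff: "mst_of n f = 0 \<longleftrightarrow> (\<forall>i<n. \<forall>j<n. f i = f j)"
proof -
  obtain G where G: "G \<subseteq> complete_graph_edges {..<n}" "graph_connected {..<n} G"
    "span_cost f G = mst_of n f"
    using span_cost_attained[of n f] unfolding connected_graphs_def by blast
  show ?thesis
  proof
    assume 0: "mst_of n f = 0"
    show "\<forall>i<n. \<forall>j<n. f i = f j"
    proof (intro allI impI)
      fix i j assume "i < n" "j < n"
      then have "reaches G i j" using G(2) by (simp add: graph_connected_def)
      then have "dist (f i) (f j) \<le> span_cost f G"
        by (rule dist_le_span_cost[OF finite_lessThan G(1)])
      then show "f i = f j" using 0 G(3) by simp
    qed
  next
    assume eq: "\<forall>i<n. \<forall>j<n. f i = f j"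
    have "edge_length (f ` e) = 0" if eG: "e \<in> G" for e
    proof -
      obtain u v where "u < n" "v < n" "e = {u, v}"
        using subsetD[OF G(1) eG] by (auto elim: complete_graph_edgesE)
      then show ?thesis using eq by (metis dist_self edge_length_doubleton image_empty image_insert)
    qed
    then show "mst_of n f = 0" using G(3) by (simp add: span_cost_def)
  qed
qed

text \<open>Every index occurs equally often in either role of an ordered pair \<open>(i, j)\<close>, so the
  contributions of \<open>r\<close> cancel.\<close>

lemma sum_transfer_gaps:
  fixes M :: real and T r :: "nat \<Rightarrow> real"
  shows "(\<Sum>i<n. \<Sum>j\<in>{..<n} - {i}. 2 * T i + r i - (M + r j))
    = (real n - 1) * (2 * (\<Sum>i<n. T i) - real n * M)"
proof -
  have "(\<Sum>j\<in>{..<n} - {i}. 2 * T i + r i - (M + r j))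
      = (real n - 1) * (2 * T i) + real n * r i - (real n - 1) * M - (\<Sum>j<n. r j)"
    if "i < n" for i
    using that by (simp add: sum_diff1 sum_subtractf sum.distrib algebra_simps)
  then have "(\<Sum>i<n. \<Sum>j\<in>{..<n} - {i}. 2 * T i + r i - (M + r j))
      = (\<Sum>i<n. (real n - 1) * (2 * T i) + real n * r i - (real n - 1) * M - (\<Sum>j<n. r j))"
    by simp
  also have "\<dots> = (real n - 1) * (2 * (\<Sum>i<n. T i) - real n * M)"
    by (simp add: sum_subtractf sum.distrib algebra_simps flip: sum_distrib_left sum_distrib_right)
  finally show ?thesis .
qed

lemma mst_of_times_le:
  assumes "n \<ge> 2"
  shows "real n * mst_of n f \<le> 2 * (\<Sum>i<n. mst_of n (f(i := z)))"
proof -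
  have "0 \<le> (\<Sum>i<n. \<Sum>j\<in>{..<n} - {i}.
      2 * mst_of n (f(i := z)) + dist z (f i) - (mst_of n f + dist z (f j)))"
    using mst_of_le_twice_upd[of _ n _ f z] by (intro sum_nonneg) simp
  also have "\<dots> = (real n - 1) * (2 * (\<Sum>i<n. mst_of n (f(i := z))) - real n * mst_of n f)"
    by (rule sum_transfer_gaps)
  finally show ?thesis using assms by (simp add: zero_le_mult_iff)
qed

section \<open>Strictness at a single configuration\<close>

text \<open>The parallelogram law leaves nothing for the norm of the sum of \<open>a - z\<close> and \<open>b - z\<close>.\<close>

lemma antipodal:
  fixes a b z :: "'a::real_inner"
  assumes "dist z a = R" "dist z b = R" "dist a b = 2 * R"
  shows "b = 2 *\<^sub>R z - a"
proof -
  have "(norm ((a - z) + (b - z)))\<^sup>2 + (norm ((a - z) - (b - z)))\<^sup>2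
      = 2 * (norm (a - z))\<^sup>2 + 2 * (norm (b - z))\<^sup>2"
    by (simp add: power2_norm_eq_inner inner_add inner_diff inner_commute)
  moreover have "norm (a - z) = R" "norm (b - z) = R" "norm ((a - z) - (b - z)) = 2 * R"
    using assms by (simp_all add: dist_norm norm_minus_commute)
  ultimately have "norm ((a - z) + (b - z)) = 0" by (simp add: power_mult_distrib)
  then show ?thesis by (simp add: algebra_simps scaleR_2)
qed

text \<open>Use the star centred at position \<open>i\<close> itself.  Each neighbour \<open>w\<close> of \<open>i\<close> contributes
  \<open>R\<close> to the cost of \<open>f(i := z)\<close> and at most \<open>2 * R\<close> to the star.  Tightness therefore makes
  all spokes have length \<open>2 * R\<close>, which puts every neighbour opposite to \<open>f i\<close>, and leaves no
  length for the remaining edges, so that every \<open>f j\<close> coincides with some neighbour.\<close>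

lemma equidistant_antipodal:
  fixes f :: "nat \<Rightarrow> 'a::real_inner"
  assumes i: "i < n" and r: "\<And>j. j < n \<Longrightarrow> dist z (f j) = R"
    and tight: "mst_of n f = 2 * mst_of n (f(i := z))"
    and j: "j < n" "j \<noteq> i"
  shows "f j = 2 *\<^sub>R z - f i"
proof -
  obtain G where G: "G \<in> connected_graphs {..<n}" "span_cost (f(i := z)) G = mst_of n (f(i := z))"
    by (rule span_cost_attained)
  have GE: "G \<subseteq> complete_graph_edges {..<n}" using G by (auto simp: connected_graphs_def)
  let ?Y = "{y. {i, y} \<in> G}"
  define A where "A = span_cost f {e \<in> G. i \<notin> e}"
  have Y: "finite ?Y" "?Y \<subseteq> {..<n}" using finite_neighbours[OF finite_lessThan GE] by auto
  have A0: "0 \<le> A" unfolding A_def using GE by (intro span_cost_nonneg[of "{..<n}"]) auto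
  have rY: "dist z (f w) = R" if "w \<in> ?Y" for w using that Y(2) r by blast
  have le: "dist (f i) (f w) \<le> 2 * R" if "w \<in> ?Y" for w
    using dist_triangle[of "f i" "f w" z] rY[OF that] r[OF i] by (simp add: dist_commute)
  have "mst_of n f \<le> A + (\<Sum>w\<in>insert i ?Y. dist (f i) (f w))"
    unfolding A_def using mst_of_le_recentred[OF G(1) i, of i f] by simp
  also have "(\<Sum>w\<in>insert i ?Y. dist (f i) (f w)) = (\<Sum>w\<in>?Y. dist (f i) (f w))"
    using Y(1) by (cases "i \<in> ?Y") (auto simp: insert_absorb)
  finally have "mst_of n f \<le> A + (\<Sum>w\<in>?Y. dist (f i) (f w))" .
  moreover have "mst_of n (f(i := z)) = A + (\<Sum>w\<in>?Y. R)"
    using span_cost_upd_split[OF finite_lessThan GE, of f i z] G(2) rY by (simp add: A_def)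
  moreover have "(\<Sum>w\<in>?Y. 2 * R - dist (f i) (f w))
      = 2 * (\<Sum>w\<in>?Y. R) - (\<Sum>w\<in>?Y. dist (f i) (f w))"
    by (simp add: sum_subtractf)
  moreover have "0 \<le> (\<Sum>w\<in>?Y. 2 * R - dist (f i) (f w))"
    using le by (intro sum_nonneg) simp
  ultimately have zero: "A = 0" "(\<Sum>w\<in>?Y. 2 * R - dist (f i) (f w)) = 0"
    using A0 tight by argo+
  have "\<forall>w\<in>?Y. 2 * R - dist (f i) (f w) = 0"
    using zero(2) by (subst (asm) sum_nonneg_eq_0_iff[OF Y(1)]) (use le in auto)
  then have "f w = 2 *\<^sub>R z - f i" if "w \<in> ?Y" for w
    using antipodal[OF r[OF i] rY[OF that]] that by auto
  moreover obtain p where "p \<in> ?Y" "dist (f p) (f j) \<le> A"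
    using nearby_neighbour[OF G(1) i j, of f] by (auto simp: A_def)
  ultimately show ?thesis using zero(1) by auto
qed

text \<open>In case of equality all the inequalities that were summed are equalities.  An index \<open>i\<close>
  different from \<open>j\<close> and \<open>k\<close>, available because \<open>n \<ge> 3\<close>, is used twice: to compare
  the distances \<open>r j\<close> and \<open>r k\<close>, and to see that \<open>f j\<close> and \<open>f k\<close> are both the reflection of \<open>f i\<close>.\<close>

lemma mst_of_times_less:
  fixes f :: "nat \<Rightarrow> 'a::real_inner"
  assumes n: "n \<ge> 3" and ne: "\<not> (\<forall>i<n. \<forall>j<n. f i = f j)"
  shows "real n * mst_of n f < 2 * (\<Sum>i<n. mst_of n (f(i := z)))"
proof (rule ccontr)
  assume "\<not> ?thesis"
  then have eq: "real n * mst_of n f = 2 * (\<Sum>i<n. mst_of n (f(i := z)))"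
    using mst_of_times_le[of n f z] n by simp
  define r where "r i = dist z (f i)" for i
  define gap where "gap i j = 2 * mst_of n (f(i := z)) + r i - (mst_of n f + r j)" for i j
  have nonneg: "0 \<le> gap i j" if "i < n" "j \<in> {..<n} - {i}" for i j
    using mst_of_le_twice_upd[of i n j f z] that by (simp add: gap_def r_def)
  have "(\<Sum>i<n. \<Sum>j\<in>{..<n} - {i}. gap i j) = 0"
    using eq sum_transfer_gaps[of "\<lambda>i. mst_of n (f(i := z))" r "mst_of n f" n]
    by (simp add: gap_def)
  then have "\<forall>i<n. (\<Sum>j\<in>{..<n} - {i}. gap i j) = 0"
    using nonneg by (subst (asm) sum_nonneg_eq_0_iff) (auto intro!: sum_nonneg)
  then have gap0: "gap i j = 0" if "i < n" "j < n" "j \<noteq> i" for i j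
    using that nonneg sum_nonneg_eq_0_iff[of "{..<n} - {i}" "gap i"] by auto
  have third: "\<exists>i<n. i \<noteq> j \<and> i \<noteq> k" for j k
  proof -
    have "card {j, k} < card {..<n}" using n card_2_iff'[of "{j, k}"] by (simp add: card_insert_if)
    then have "\<not> {..<n} \<subseteq> {j, k}" by (metis card_mono finite.emptyI finite.insertI not_le)
    then show ?thesis by auto
  qed
  have r_eq: "r j = r 0" if "j < n" for j
  proof -
    obtain i where "i < n" "i \<noteq> j" "i \<noteq> 0" using third by blast
    then show ?thesis using gap0[of i j] gap0[of i 0] that n by (simp add: gap_def)
  qed
  have anti: "f j = 2 *\<^sub>R z - f i" if "i < n" "j < n" "j \<noteq> i" for i j
  proof (rule equidistant_antipodal[OF that(1) _ _ that(2,3)])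
    show "dist z (f j) = r 0" if "j < n" for j using r_eq[OF that] by (simp add: r_def)
    show "mst_of n f = 2 * mst_of n (f(i := z))"
      using gap0[OF that] r_eq[OF that(1)] r_eq[OF that(2)] by (simp add: gap_def)
  qed
  have "f j = f k" if "j < n" "k < n" for j k
  proof -
    obtain i where "i < n" "i \<noteq> j" "i \<noteq> k" using third by blast
    then show ?thesis using anti[of i j] anti[of i k] that by simp
  qed
  with ne show False by blast
qed

section \<open>A uniform bound by compactness\<close>

lemma mst_of_similarity_le:
  assumes "\<And>i j. i < n \<Longrightarrow> j < n \<Longrightarrow> dist (g i) (g j) = c * dist (f i) (f j)"
  shows "mst_of n g \<le> c * mst_of n f"
proof -
  obtain G where G: "G \<in> connected_graphs {..<n}" "span_cost f G = mst_of n f"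
    by (rule span_cost_attained)
  have "edge_length (g ` e) = c * edge_length (f ` e)" if "e \<in> G" for e
  proof -
    have "e \<in> complete_graph_edges {..<n}" using that G by (auto simp: connected_graphs_def)
    then obtain u v where "u < n" "v < n" "e = {u, v}" by (auto elim: complete_graph_edgesE)
    then show ?thesis using assms by simp
  qed
  then have "span_cost g G = c * span_cost f G"
    by (simp add: span_cost_def sum_distrib_left)
  then show ?thesis using mst_of_le_span_cost[OF G(1), of g] G(2) by simp
qed

lemma mst_of_similarity:
  assumes c: "c > 0" and sim: "\<And>i j. i < n \<Longrightarrow> j < n \<Longrightarrow> dist (g i) (g j) = c * dist (f i) (f j)"
  shows "mst_of n g = c * mst_of n f"
proof (rule antisym)
  have "dist (f i) (f j) = inverse c * dist (g i) (g j)" if "i < n" "j < n" for i j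
    using sim[OF that] c by simp
  then have "mst_of n f \<le> inverse c * mst_of n g" by (rule mst_of_similarity_le)
  then show "c * mst_of n f \<le> mst_of n g" using c by (simp add: field_simps)
qed (rule mst_of_similarity_le[OF sim])

lemma continuous_on_Min:
  fixes h :: "'i \<Rightarrow> 'a::topological_space \<Rightarrow> 'b::linorder_topology"
  assumes "finite C" "C \<noteq> {}" "\<And>c. c \<in> C \<Longrightarrow> continuous_on S (h c)"
  shows "continuous_on S (\<lambda>x. Min ((\<lambda>c. h c x) ` C))"
  using assms
proof (induction C rule: finite_ne_induct)
  case (insert c C)
  then show ?case by (simp add: continuous_on_min)
qed simp

lemma continuous_on_mst_of:
  fixes g :: "'b::topological_space \<Rightarrow> nat \<Rightarrow> 'a::metric_space"
  assumes "\<And>i. i < n \<Longrightarrow> continuous_on S (\<lambda>x. g x i)"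
  shows "continuous_on S (\<lambda>x. mst_of n (g x))"
  unfolding mst_of_eq_Min
proof (rule continuous_on_Min)
  show "finite (connected_graphs {..<n})" by (rule finite_connected_graphs)
  show "connected_graphs {..<n} \<noteq> {}"
    using graph_connected_complete unfolding connected_graphs_def by blast
  fix G assume "G \<in> connected_graphs {..<n}"
  then have GE: "G \<subseteq> complete_graph_edges {..<n}" by (simp add: connected_graphs_def)
  show "continuous_on S (\<lambda>x. span_cost (g x) G)"
    unfolding span_cost_def
  proof (rule continuous_on_sum)
    fix e assume "e \<in> G"
    then have "e \<in> complete_graph_edges {..<n}" using GE by blast
    then obtain u v where "u < n" "v < n" "e = {u, v}" by (auto elim: complete_graph_edgesE)
    then show "continuous_on S (\<lambda>x. edge_length (g x ` e))"
      using assms by (simp add: continuous_on_dist)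
  qed
qed

text \<open>For any \<open>j \<noteq> i\<close>, replacing position \<open>j\<close> leaves both \<open>z\<close> and \<open>f i\<close> among the
  arguments.\<close>

lemma sum_mst_of_upd_pos:
  assumes n: "n \<ge> 2" and i: "i < n" "f i \<noteq> z"
  shows "0 < (\<Sum>i<n. mst_of n (f(i := z)))"
proof -
  define j :: nat where "j = (if i = 0 then 1 else 0)"
  then have j: "j < n" "j \<noteq> i" using n by auto
  have "mst_of n (f(j := z)) \<noteq> 0"
    unfolding mst_of_eq_0_iff using i j by (metis fun_upd_apply)
  then show ?thesis
    using j(1) mst_of_nonneg by (intro sum_pos2[of _ j]) (auto simp: less_le)
qed

text \<open>Configurations are functions on all of \<open>nat\<close> with the product topology, so the values
  beyond \<open>n\<close> are pinned to \<open>0\<close> to obtain a compact set by Tychonoff's theorem.\<close>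

lemma compact_unit_configurations:
  fixes n :: nat
  shows "compact {f :: nat \<Rightarrow> 'a::euclidean_space. (\<forall>i\<ge>n. f i = 0) \<and> (\<Sum>i<n. norm (f i)) = 1}"
    (is "compact ?K")
proof -
  define B :: "nat \<Rightarrow> 'a set" where "B i = (if i < n then cball 0 1 else {0})" for i
  have "compactin (product_topology (\<lambda>i. euclidean) UNIV) (PiE UNIV B)"
    unfolding compactin_PiE by (simp add: B_def)
  then have "compact (PiE UNIV B)" by (simp add: euclidean_product_topology)
  moreover have "closed {f :: nat \<Rightarrow> 'a. (\<Sum>i<n. norm (f i)) = 1}"
    by (intro closed_Collect_eq continuous_on_sum continuous_on_norm
        continuous_on_product_coordinates continuous_on_const)
  moreover have "?K = PiE UNIV B \<inter> {f. (\<Sum>i<n. norm (f i)) = 1}"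
  proof -
    have "norm (f i) \<le> 1" if "(\<Sum>i<n. norm (f i)) = 1" "i < n" for f :: "nat \<Rightarrow> 'a" and i
      using member_le_sum[of i "{..<n}" "\<lambda>i. norm (f i)"] that by simp
    then show ?thesis by (auto simp: B_def PiE_def Pi_def split: if_splits)
  qed
  ultimately show ?thesis by (simp add: compact_Int_closed)
qed

text \<open>The number \<open>\<kappa>\<close> is the maximum of the ratio over the normalised configurations, attained
  at \<open>g\<close>.  If all points of \<open>g\<close> coincide, the ratio is \<open>0\<close>; its denominator is positive even
  then, because that common point is not the origin.\<close>

lemma mst_of_uniform_bound_origin:
  assumes n: "n \<ge> 3"
  shows "\<exists>\<kappa><2 / real n. \<forall>f :: nat \<Rightarrow> 'a::euclidean_space.
    mst_of n f \<le> \<kappa> * (\<Sum>i<n. mst_of n (f(i := 0)))"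
proof -
  define K where "K = {f :: nat \<Rightarrow> 'a. (\<forall>i\<ge>n. f i = 0) \<and> (\<Sum>i<n. norm (f i)) = 1}"
  define D where "D f = (\<Sum>i<n. mst_of n (f(i := 0)))" for f :: "nat \<Rightarrow> 'a"
  have D_pos: "0 < D f" if "i < n" "f i \<noteq> 0" for f i
    unfolding D_def using n that by (intro sum_mst_of_upd_pos) auto
  have nonzero: "\<exists>i<n. f i \<noteq> 0" if "(\<Sum>i<n. norm (f i)) \<noteq> 0" for f :: "nat \<Rightarrow> 'a"
  proof (rule ccontr)
    assume "\<not> ?thesis"
    then have "(\<Sum>i<n. norm (f i)) = 0" by simp
    with that show False by blast
  qed
  have K_pos: "0 < D f" if "f \<in> K" for f
    using that nonzero[of f] D_pos by (auto simp: K_def)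
  have "compact K" unfolding K_def by (rule compact_unit_configurations)
  moreover have "K \<noteq> {}"
  proof -
    obtain b :: 'a where "norm b = 1" using vector_choose_size[of 1] by auto
    then have "(\<lambda>i. if i = 0 then b else 0) \<in> K"
      using n by (simp add: K_def if_distrib[of norm] cong: if_cong)
    then show ?thesis by blast
  qed
  moreover have "continuous_on K (\<lambda>f. mst_of n f / D f)"
  proof (rule continuous_on_divide)
    show "continuous_on K (\<lambda>f. mst_of n f)"
      by (intro continuous_on_mst_of continuous_on_subset[OF continuous_on_product_coordinates]) simp
    have "continuous_on K (\<lambda>f. (f(i := 0)) k)" for i k
      by (cases "k = i")
        (auto intro: continuous_on_subset[OF continuous_on_product_coordinates])
    then show "continuous_on K D"
      unfolding D_def by (intro continuous_on_sum continuous_on_mst_of)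
    show "\<forall>f\<in>K. D f \<noteq> 0" using K_pos by force
  qed
  ultimately obtain g where g: "g \<in> K" "\<And>f. f \<in> K \<Longrightarrow> mst_of n f / D f \<le> mst_of n g / D g"
    using continuous_attains_sup[of K "\<lambda>f. mst_of n f / D f"] by blast
  define \<kappa> where "\<kappa> = mst_of n g / D g"
  have "real n * mst_of n g < 2 * D g"
  proof (cases "\<forall>i<n. \<forall>j<n. g i = g j")
    case True
    then have "mst_of n g = 0" using mst_of_eq_0_iff by blast
    then show ?thesis using K_pos[OF g(1)] by simp
  next
    case False
    then show ?thesis unfolding D_def by (rule mst_of_times_less[OF n])
  qed
  then have "\<kappa> < 2 / real n" using K_pos[OF g(1)] n by (simp add: \<kappa>_def field_simps)
  moreover have "mst_of n f \<le> \<kappa> * D f" for f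
  proof -
    define N where "N = (\<Sum>i<n. norm (f i))"
    have N0: "N \<ge> 0" unfolding N_def by (simp add: sum_nonneg)
    show ?thesis
    proof (cases "N = 0")
      case True
      then have "\<forall>i<n. f i = 0" by (auto simp: N_def sum_nonneg_eq_0_iff)
      then have "mst_of n f = 0" by (simp add: mst_of_eq_0_iff)
      moreover have "0 \<le> D f" "0 \<le> \<kappa>"
        unfolding \<kappa>_def D_def by (intro divide_nonneg_nonneg sum_nonneg mst_of_nonneg)+
      ultimately show ?thesis by simp
    next
      case False
      with N0 have N: "N > 0" by simp
      define h where "h i = (if i < n then inverse N *\<^sub>R f i else 0)" for i
      have "(\<Sum>i<n. norm (h i)) = inverse N * N"
        unfolding N_def sum_distrib_left using N by (intro sum.cong) (auto simp: h_def N_def)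
      then have hK: "h \<in> K" using N by (simp add: K_def h_def)
      have sim: "mst_of n h' = inverse N * mst_of n f'"
        if "\<And>i. i < n \<Longrightarrow> h' i = inverse N *\<^sub>R f' i" for h' f' :: "nat \<Rightarrow> 'a"
        using N that by (intro mst_of_similarity) (auto simp: dist_norm simp flip: scaleR_diff_right)
      have "mst_of n h = inverse N * mst_of n f" by (rule sim) (simp add: h_def)
      moreover have "D h = inverse N * D f"
        unfolding D_def sum_distrib_left by (intro sum.cong sim) (auto simp: h_def)
      ultimately have "mst_of n f / D f \<le> \<kappa>" using g(2)[OF hK] N by (simp add: \<kappa>_def)
      moreover have "0 < D f" using nonzero[of f] False D_pos by (auto simp: N_def)
      ultimately show ?thesis by (simp add: field_simps)
    qed
  qed
  ultimately show ?thesis unfolding D_def by blast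
qed

lemma mst_of_uniform_bound:
  assumes "n \<ge> 3"
  shows "\<exists>\<kappa><2 / real n. \<forall>(f :: nat \<Rightarrow> 'a::euclidean_space) z.
    mst_of n f \<le> \<kappa> * (\<Sum>i<n. mst_of n (f(i := z)))"
proof -
  obtain \<kappa> where \<kappa>: "\<kappa> < 2 / real n"
    "\<And>f :: nat \<Rightarrow> 'a. mst_of n f \<le> \<kappa> * (\<Sum>i<n. mst_of n (f(i := 0)))"
    using mst_of_uniform_bound_origin[OF assms] by blast
  have "mst_of n f \<le> \<kappa> * (\<Sum>i<n. mst_of n (f(i := z)))" for f :: "nat \<Rightarrow> 'a" and z
  proof -
    have "mst_of n h = 1 * mst_of n f'"
      if "\<And>i. h i = f' i - z" for h f' :: "nat \<Rightarrow> 'a"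
      using that by (intro mst_of_similarity) (auto simp: dist_norm)
    then have "mst_of n (\<lambda>i. f i - z) = mst_of n f"
      "mst_of n ((\<lambda>i. f i - z)(i := 0)) = mst_of n (f(i := z))" for i
      by (simp_all add: fun_upd_def)
    then show ?thesis using \<kappa>(2)[of "\<lambda>i. f i - z"] by simp
  qed
  with \<kappa>(1) show ?thesis by blast
qed

section \<open>The n-distance\<close>

lemma mst_length_nth:
  assumes "length xs = n"
  shows "mst_length xs = mst_of n ((!) xs)"
proof -
  have "xs = map ((!) xs) [0..<n]" using map_nth[of xs] assms by simp
  then show ?thesis by (rule arg_cong)
qed

lemma mst_length_list_update:
  "length xs = n \<Longrightarrow> i < n \<Longrightarrow> mst_length (xs[i := z]) = mst_of n (((!) xs)(i := z))"
proof -
  assume "length xs = n" "i < n"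
  then have "xs[i := z] = map (((!) xs)(i := z)) [0..<n]"
    by (intro nth_equalityI) (auto simp: nth_list_update)
  then show ?thesis by simp
qed

lemma mst_length_times_le:
  assumes "n \<ge> 2" "length xs = n"
  shows "real n * mst_length xs \<le> 2 * (\<Sum>i<n. mst_length (xs[i := z]))"
proof -
  have "mst_length (xs[i := z]) = mst_of n (((!) xs)(i := z))" if "i < n" for i
    using assms(2) that by (rule mst_length_list_update)
  then show ?thesis
    using mst_of_times_le[OF assms(1), of "(!) xs" z] mst_length_nth[OF assms(2)] by simp
qed

lemma n_distance_mst_length:
  assumes n: "n \<ge> 2" and ne: "\<exists>x y :: 'a::metric_space. x \<noteq> y"
  shows "n_distance n UNIV (mst_length :: 'a list \<Rightarrow> real)"
  unfolding n_distance_def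
proof (intro conjI ballI allI impI)
  show "\<exists>x\<in>UNIV. \<exists>y\<in>UNIV. (x::'a) \<noteq> y" using ne by blast
next
  fix xs :: "'a list" assume "xs \<in> tuples n UNIV"
  then have len: "length xs = n" by (simp add: tuples_def)
  show "0 \<le> mst_length xs" unfolding mst_length_nth[OF len] by (rule mst_of_nonneg)
  show "mst_length xs = 0 \<longleftrightarrow> (\<forall>i<n. \<forall>j<n. xs ! i = xs ! j)"
    unfolding mst_length_nth[OF len] by (rule mst_of_eq_0_iff)
  show "mst_length (permute_list p xs) = mst_length xs" if "p permutes {..<n}" for p
    using that len by (simp add: mst_length_def set_permute_list)
  fix z
  have "0 \<le> mst_length xs" unfolding mst_length_nth[OF len] by (rule mst_of_nonneg)
  then have "2 * mst_length xs \<le> real n * mst_length xs" using n by (intro mult_right_mono) auto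
  with mst_length_times_le[OF n len, of z]
  show "mst_length xs \<le> (\<Sum>i<n. mst_length (xs[i := z]))" by simp
qed (rule n)

lemma best_constant_le:
  assumes d: "n_distance n X d"
    and le: "\<And>xs z. xs \<in> tuples n X \<Longrightarrow> z \<in> X \<Longrightarrow> d xs \<le> \<kappa> * (\<Sum>i<n. d (xs[i := z]))"
  shows "best_constant n X d \<le> \<kappa>"
  unfolding best_constant_def
proof (rule cSup_least[OF constant_ratios_nonempty[OF d]])
  fix q assume "q \<in> constant_ratios n X d"
  then obtain xs z where xs: "xs \<in> tuples n X" "z \<in> X" "card (set xs) \<ge> 2"
    and q: "q = d xs / (\<Sum>i<n. d (xs[i := z]))"
    unfolding constant_ratios_def by blast
  from constant_ratio_denominator_pos[OF d xs] le[OF xs(1,2)]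
  show "q \<le> \<kappa>" by (simp add: q divide_le_eq)
qed

theorem proposition4p4:
  fixes n :: nat
  assumes "CARD('q::finite) \<ge> 2" and "n \<ge> 2"
  shows "n_distance n UNIV (mst_length :: (real ^ 'q) list \<Rightarrow> real) \<and>
         best_constant n UNIV (mst_length :: (real ^ 'q) list \<Rightarrow> real) \<le> 2 / real n \<and>
         (n \<ge> 3 \<longrightarrow> best_constant n UNIV (mst_length :: (real ^ 'q) list \<Rightarrow> real) < 2 / real n)"
proof (intro conjI impI)
  have "(0 :: real ^ 'q) \<noteq> 1" by simp
  then show d: "n_distance n UNIV (mst_length :: (real ^ 'q) list \<Rightarrow> real)"
    using assms(2) by (intro n_distance_mst_length) auto
  show "best_constant n UNIV (mst_length :: (real ^ 'q) list \<Rightarrow> real) \<le> 2 / real n"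
  proof (rule best_constant_le[OF d])
    fix xs :: "(real ^ 'q) list" and z assume "xs \<in> tuples n UNIV"
    then have "real n * mst_length xs \<le> 2 * (\<Sum>i<n. mst_length (xs[i := z]))"
      using assms(2) by (intro mst_length_times_le) (simp_all add: tuples_def)
    then show "mst_length xs \<le> 2 / real n * (\<Sum>i<n. mst_length (xs[i := z]))"
      using assms(2) by (simp add: field_simps)
  qed
  assume "n \<ge> 3"
  then obtain \<kappa> where \<kappa>: "\<kappa> < 2 / real n"
    "\<And>(f :: nat \<Rightarrow> real ^ 'q) z. mst_of n f \<le> \<kappa> * (\<Sum>i<n. mst_of n (f(i := z)))"
    using mst_of_uniform_bound by blast
  have "best_constant n UNIV (mst_length :: (real ^ 'q) list \<Rightarrow> real) \<le> \<kappa>"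
  proof (rule best_constant_le[OF d])
    fix xs :: "(real ^ 'q) list" and z assume "xs \<in> tuples n UNIV"
    then have len: "length xs = n" by (simp add: tuples_def)
    have "mst_length (xs[i := z]) = mst_of n (((!) xs)(i := z))" if "i < n" for i
      using len that by (rule mst_length_list_update)
    then show "mst_length xs \<le> \<kappa> * (\<Sum>i<n. mst_length (xs[i := z]))"
      using \<kappa>(2)[of "(!) xs" z] mst_length_nth[OF len] by simp
  qed
  with \<kappa>(1) show "best_constant n UNIV (mst_length :: (real ^ 'q) list \<Rightarrow> real) < 2 / real n"
    by simp
qed

end
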